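(* Let $p$ be a prime and let $A \subseteq \mathbb{Z}_p \setminus \{0\}$ with $|A| = k = p-3$ such that the sum of the elements of $A$ is nonzero. Then there is an ordering $(a_1,\ldots,a_k)$ of the elements of $A$ whose partial sums $s_0, s_1, \ldots, s_k$ satisfy $s_i \neq s_j$ for all $0 \leq i < j \leq k$.
   Context: For an ordering $(a_1,\ldots,a_k)$, the partial sums are $s_0 = 0$ and $s_j = \sum_{i=1}^j a_i$ for $1 \leq j \leq k$. $\mathbb{Z}_p$ denotes the integers modulo $p$. *)

theory Defs
  imports "HOL-Number_Theory.Residues"
begin

text \<open>
  An ordering \<open>(a\<^sub>1, \<dots>, a\<^sub>k)\<close> of elements of an additively written group \<open>G\<close> is a list
  \<open>as\<close> with \<open>a\<^sub>i = as ! (i - 1)\<close>.  The sum below is the empty sum for \<open>j = 0\<close>; it is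
  meaningful only for \<open>j \<le> length as\<close>.
\<close>

definition partial_sum :: "('a, 'b) ring_scheme \<Rightarrow> 'a list \<Rightarrow> nat \<Rightarrow> 'a" where
  "partial_sum G as j = (\<Oplus>\<^bsub>G\<^esub>i\<in>{1..j}. as ! (i - 1))"

end

theory Submission
  imports Defs
begin

text \<open>
  Write \<open>p = 2h + 1\<close>.  The zigzag \<open>0, -1, 1, -2, 2, \<dots>\<close> with one vertex skipped halfway is
  a closed walk through \<open>2h\<close> vertices of \<open>\<int>\<^sub>p\<close> whose differences
  \<open>-1, 2, -3, \<dots>, \<plusminus>h, \<plusminus>(h - 1), \<dots>, -2, 1, \<minusplus>h\<close> run through all nonzero residues.
  For each \<open>0 < i < h\<close> the differences \<open>i\<close> and \<open>-(i + 1)\<close> are adjacent up to a common sign.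
  If \<open>x\<close> and \<open>y\<close> are the two nonzero residues missing from \<open>A\<close>, then \<open>x + y\<close> is nonzero, and
  \<open>x = c i\<close>, \<open>y = -c (i + 1)\<close> with \<open>c = -(x + y)\<close>.  Exchanging \<open>x\<close> and \<open>y\<close> replaces \<open>i\<close> by
  \<open>2h - i\<close>, so \<open>0 < i < h\<close> may be assumed.  Scaling the closed walk by \<open>\<plusminus>c\<close> and deleting the
  vertex between these two differences leaves a path whose differences are exactly \<open>A\<close>.
\<close>

section \<open>The closed zigzag walk modulo \<open>2 * h + 1\<close>\<close>

definition zz_vertex :: "nat \<Rightarrow> nat \<Rightarrow> int" where
  "zz_vertex h j =
     (if even j then int (j div 2) + (if odd h \<and> h < j then 1 else 0)
      else - int (j div 2) - 1 - (if even h \<and> h < j then 1 else 0))"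

text \<open>For \<open>j < 2 * h\<close> this is the representative of least absolute value of the
  step from vertex \<open>j\<close> to its cyclic successor. The last branch is the closing step
  back to vertex 0.\<close>

definition zz_diff :: "nat \<Rightarrow> nat \<Rightarrow> int" where
  "zz_diff h j =
     (if j < h then (if even j then - int j - 1 else int j + 1)
      else if j < 2 * h - 1 then (if even j then 2 * int h - 1 - int j else int j + 1 - 2 * int h)
      else if even h then - int h else int h)"

lemma zz_vertex_step:
  assumes "j < 2 * h"
  shows "[zz_vertex h (Suc j mod (2 * h)) - zz_vertex h j = zz_diff h j] (mod (2 * int h + 1))"
proof -
  let ?p = "2 * int h + 1"
  let ?e = "zz_vertex h (Suc j mod (2 * h)) - zz_vertex h j - zz_diff h j"
  \<comment> \<open>Steps with \<open>j < h\<close> are exact. From \<open>h\<close> on, each step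
    before the closing one has exactly one end shifted by the skip, hence length
    \<open>j + 2\<close>, one modulus away from the prescribed value. The closing step is off only
    for even \<open>h\<close>.\<close>
  have "?e = 0 \<or> ?e = ?p \<or> ?e = - ?p"
  proof (cases "j = 2 * h - 1")
    case True
    then have "Suc j mod (2 * h) = 0" "odd j" "\<not> j < h" "j div 2 = h - 1"
      using assms by auto
    moreover have "h < j" if "even h"
      using that assms True by (cases "h = 1") auto
    ultimately show ?thesis
      using assms True by (auto simp: zz_vertex_def zz_diff_def)
  next
    case False
    then have "Suc j mod (2 * h) = Suc j"
      using assms by (intro mod_less) linarith
    show ?thesis
    proof (cases "even j")
      case True
      then obtain a where "j = 2 * a" ..
      with assms \<open>j \<noteq> 2 * h - 1\<close> \<open>Suc j mod (2 * h) = Suc j\<close> show ?thesis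
        by (cases "even h") (auto simp: zz_vertex_def zz_diff_def)
    next
      case False
      then obtain a where "j = 2 * a + 1" ..
      with assms \<open>j \<noteq> 2 * h - 1\<close> \<open>Suc j mod (2 * h) = Suc j\<close> show ?thesis
        by (cases "even h") (auto simp: zz_vertex_def zz_diff_def)
    qed
  qed
  then have "?p dvd ?e"
    by (metis dvd_refl dvd_0_right dvd_minus_iff)
  then show ?thesis
    by (simp add: cong_iff_dvd_diff)
qed

lemma cong_imp_eq_int:
  fixes a b m :: int
  assumes "[a = b] (mod m)" "\<bar>a - b\<bar> < m"
  shows "a = b"
proof (rule ccontr)
  assume "a \<noteq> b"
  then have "\<bar>m\<bar> \<le> \<bar>a - b\<bar>"
    using assms(1) by (intro dvd_imp_le_int) (simp_all add: cong_iff_dvd_diff)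
  with assms(2) show False
    by linarith
qed

text \<open>All vertices lie in a window of \<open>2 * h + 1\<close> consecutive integers, placed
  according to which branch the skip shifts, so congruent vertices are equal. The sign then gives
  the parity of the index, and each branch is strictly monotone.\<close>

lemma zz_vertex_cong_imp_eq:
  assumes "i < 2 * h" "j < 2 * h" "[zz_vertex h i = zz_vertex h j] (mod (2 * int h + 1))"
  shows "i = j"
proof -
  have "zz_vertex h l \<in> (if even h then {- int h - 1..int h - 1} else {- int h..int h})"
    if "l < 2 * h" for l
    using that by (cases "even l"; cases "even h") (auto simp: zz_vertex_def elim!: evenE oddE)
  from this[OF assms(1)] this[OF assms(2)] have "zz_vertex h i = zz_vertex h j"
    by (intro cong_imp_eq_int[OF assms(3)]) (auto split: if_splits)
  then show ?thesis
    by (auto simp: zz_vertex_def split: if_splits elim!: evenE oddE)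
qed

text \<open>An absolute value \<open>0 < i < h\<close> occurs at the indices \<open>i - 1\<close>
  and \<open>2 * h - 1 - i\<close>, of equal parity but in different halves, hence with opposite
  signs. The value \<open>h\<close> occurs at \<open>h - 1\<close> and \<open>2 * h - 1\<close>,
  again with opposite signs.\<close>

lemma zz_diff_eq_imp_eq:
  assumes "i < 2 * h" "j < 2 * h" "zz_diff h i = zz_diff h j"
  shows "i = j"
proof -
  have D: "if even l then zz_diff h l = - int l - 1 \<and> l < h \<or>
        zz_diff h l = 2 * int h - 1 - int l \<and> h \<le> l \<and> l < 2 * h - 1
      else zz_diff h l = int l + 1 \<and> l < h \<or>
        zz_diff h l = int l + 1 - 2 * int h \<and> h \<le> l \<and> l < 2 * h - 1 \<or>
        l = 2 * h - 1 \<and> \<bar>zz_diff h l\<bar> = int h \<and> (0 < zz_diff h l \<longleftrightarrow> odd h)"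
    if "l < 2 * h" for l
    using that by (cases "l = 2 * h - 1") (auto simp: zz_diff_def)
  show ?thesis
    using D[OF assms(1)] D[OF assms(2)] assms(3)
    by (auto split: if_splits elim!: evenE oddE) presburger+
qed

lemma zz_diff_cong_imp_eq:
  assumes "i < 2 * h" "j < 2 * h" "[zz_diff h i = zz_diff h j] (mod (2 * int h + 1))"
  shows "i = j"
proof -
  have "\<bar>zz_diff h l\<bar> \<le> int h" if "l < 2 * h" for l
    using that by (auto simp: zz_diff_def)
  from this[OF assms(1)] this[OF assms(2)] have "zz_diff h i = zz_diff h j"
    by (intro cong_imp_eq_int[OF assms(3)]) linarith
  with assms(1,2) show ?thesis
    by (rule zz_diff_eq_imp_eq)
qed

lemma zz_diff_not_cong_0:
  assumes "j < 2 * h"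
  shows "\<not> [zz_diff h j = 0] (mod (2 * int h + 1))"
proof
  assume "[zz_diff h j = 0] (mod (2 * int h + 1))"
  then have "zz_diff h j = 0"
    using assms by (intro cong_imp_eq_int) (auto simp: zz_diff_def)
  then show False
    using assms by (auto simp: zz_diff_def split: if_splits)
qed

section \<open>Partial sums along a walk\<close>

lemma partial_sum_differences:
  fixes m :: int and w :: "nat \<Rightarrow> int"
  assumes "1 < m" "n \<le> k"
  shows "partial_sum (residue_ring m) (map (\<lambda>t. (w (Suc t) - w t) mod m) [0..<k]) n
       = (w n - w 0) mod m"
proof -
  interpret residues m "residue_ring m"
    using assms(1) by unfold_locales simp_all
  let ?f = "\<lambda>i. w i - w (i - 1)"
  have "partial_sum (residue_ring m) (map (\<lambda>t. (w (Suc t) - w t) mod m) [0..<k]) n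
      = (\<Oplus>\<^bsub>residue_ring m\<^esub>i\<in>{1..n}. ?f i mod m)"
    unfolding partial_sum_def using assms
    by (intro finsum_cong') (auto simp: mod_in_carrier)
  also have "\<dots> = (\<Sum>i\<in>{1..n}. ?f i) mod m"
    by (simp add: sum_cong)
  \<comment> \<open>Telescoping: distinct partial sums thus amount to walk vertices distinct modulo
    \<open>m\<close>.\<close>
  also have "(\<Sum>i\<in>{1..n}. ?f i) = w n - w 0"
    by (induction n) auto
  finally show ?thesis .
qed

section \<open>Two residues as adjacent differences of a scaled zigzag\<close>

lemma adjacent_zz_diffs_lt:
  fixes x y m :: int
  assumes "0 < i" "i < h" "m dvd x + (x + y) * int i" "coprime (x + y) m"
  shows "\<exists>c j. Suc j < h \<and> coprime c m \<and> [x = c * zz_diff h j] (mod m) \<and>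
           [y = c * zz_diff h (Suc j)] (mod m)"
proof -
  define j where "j = i - 1"
  \<comment> \<open>Below \<open>h\<close>, \<open>zz_diff\<close> is negative exactly at even
    indices; \<open>c\<close> absorbs this sign.\<close>
  define c where "c = (if even j then x + y else - (x + y))"
  have j: "Suc j < h" "int i = int j + 1"
    using assms(1,2) by (auto simp: j_def)
  have c: "coprime c m"
    using assms(4) unfolding c_def by (metis coprime_minus_left_iff)
  \<comment> \<open>As \<open>y = (x + y) - x\<close>, the congruence of \<open>x\<close> with
    \<open>-(x + y) * i\<close> makes \<open>y\<close> congruent to
    \<open>(x + y) * (i + 1)\<close>.\<close>
  have "x - c * zz_diff h j = x + (x + y) * int i"
    and "y - c * zz_diff h (Suc j) = - (x + (x + y) * int i)"
    using j by (auto simp: c_def zz_diff_def algebra_simps)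
  then have "[x = c * zz_diff h j] (mod m)" "[y = c * zz_diff h (Suc j)] (mod m)"
    using assms(3) by (metis cong_iff_dvd_diff dvd_minus_iff)+
  with j(1) c show ?thesis
    by blast
qed

lemma adjacent_zz_diffs:
  fixes x y :: int
  assumes "prime (2 * int h + 1)"
    and "\<not> 2 * int h + 1 dvd x" "\<not> 2 * int h + 1 dvd y"
    and "\<not> 2 * int h + 1 dvd x - y" "\<not> 2 * int h + 1 dvd x + y"
  shows "\<exists>x' y' c j. {x', y'} = {x, y} \<and> Suc j < h \<and> coprime c (2 * int h + 1) \<and>
           [x' = c * zz_diff h j] (mod 2 * int h + 1) \<and>
           [y' = c * zz_diff h (Suc j)] (mod 2 * int h + 1)"
proof -
  define p where "p = 2 * int h + 1"
  note assms = assms[folded p_def]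
  have cop: "coprime (x + y) p"
    using assms(1,5) prime_imp_coprime coprime_commute by blast
  then obtain u where u: "[(x + y) * u = 1] (mod p)"
    by (auto dest: cong_solve_coprime_int)
  \<comment> \<open>With \<open>u\<close> inverse to \<open>x + y\<close>, this is the residue of
    \<open>-x / (x + y)\<close>.\<close>
  define i where "i = nat ((- x * u) mod p)"
  have i: "int i = (- x * u) mod p" "i \<le> 2 * h"
    using pos_mod_bound[of p "- x * u"] by (auto simp: i_def p_def nat_le_iff)
  have "[x + (x + y) * int i = x + (x + y) * (- x * u)] (mod p)"
    by (intro cong_add cong_mult cong_refl) (simp add: i(1) cong_def)
  also have "x + (x + y) * (- x * u) = x - x * ((x + y) * u)"
    by (simp add: algebra_simps)
  also have "[\<dots> = x - x * 1] (mod p)"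
    by (intro cong_diff cong_mult cong_refl u)
  finally have dvd: "p dvd x + (x + y) * int i"
    by (simp add: cong_0_iff)
  then obtain q where q: "x + (x + y) * int i = p * q" ..
  \<comment> \<open>The values 0, \<open>2 * h\<close> and \<open>h\<close> are the residues of 0,
    -1 and -1/2; they would force \<open>p\<close> to divide \<open>x\<close>, \<open>y\<close> and
    \<open>x - y\<close> respectively.\<close>
  have "i \<noteq> 0"
    using dvd assms(2) by (metis add_0_right mult_zero_right of_nat_0)
  have "i \<noteq> 2 * h"
  proof
    assume "i = 2 * h"
    then have "y = p * (x + y - q)"
      using q by (simp add: p_def algebra_simps)
    then show False
      using assms(3) by (metis dvd_triv_left)
  qed
  have "i \<noteq> h"
  proof
    assume "i = h"
    then have "x - y = p * (2 * q - x - y)"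
      using q by (simp add: p_def algebra_simps)
    then show False
      using assms(4) by (metis dvd_triv_left)
  qed
  show ?thesis
  proof (cases "i < h")
    case True
    then obtain c j where "Suc j < h" "coprime c p" "[x = c * zz_diff h j] (mod p)"
        "[y = c * zz_diff h (Suc j)] (mod p)"
      using adjacent_zz_diffs_lt[OF _ _ dvd cop] \<open>i \<noteq> 0\<close> by blast
    then show ?thesis
      unfolding p_def by blast
  next
    case False
    \<comment> \<open>Exchanging \<open>x\<close> and \<open>y\<close> turns \<open>i\<close> into
      \<open>-1 - i\<close>, whose residue is \<open>2 * h - i\<close>.\<close>
    have "y + (y + x) * int (2 * h - i) = p * (x + y - q)"
      using i(2) q by (simp add: p_def of_nat_diff algebra_simps)
    then have "p dvd y + (y + x) * int (2 * h - i)"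
      by simp
    moreover have "0 < 2 * h - i" "2 * h - i < h"
      using False \<open>i \<noteq> 2 * h\<close> \<open>i \<noteq> h\<close> i(2) by auto
    moreover have "coprime (y + x) p"
      using cop by (simp add: add.commute)
    ultimately obtain c j where "Suc j < h" "coprime c p" "[y = c * zz_diff h j] (mod p)"
        "[x = c * zz_diff h (Suc j)] (mod p)"
      using adjacent_zz_diffs_lt by blast
    then show ?thesis
      unfolding p_def using insert_commute[of y x "{}"] by blast
  qed
qed

theorem theorem4p6:
  fixes p k :: nat and A :: "int set"
  defines "Zp \<equiv> residue_ring (int p)"
  assumes "prime p"
    and "A \<subseteq> carrier Zp - {\<zero>\<^bsub>Zp\<^esub>}"
    and "card A = k"
    and "int k = int p - 3"
    and "(\<Oplus>\<^bsub>Zp\<^esub>a\<in>A. a) \<noteq> \<zero>\<^bsub>Zp\<^esub>"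
  shows "\<exists>as. length as = k \<and> distinct as \<and> set as = A \<and>
           (\<forall>i j. i < j \<and> j \<le> k \<longrightarrow> partial_sum Zp as i \<noteq> partial_sum Zp as j)"
proof -

  \<comment> \<open>The two missing residues\<close>
  have "p \<noteq> 2"
    using assms(5) by auto
  then obtain h where p: "p = 2 * h + 1"
    using \<open>prime p\<close> by (metis oddE prime_odd_nat prime_ge_2_nat order_le_less)
  have ip: "int p = 2 * int h + 1" and p1: "1 < int p"
    using p prime_gt_1_nat[OF \<open>prime p\<close>] by auto
  interpret residues "int p" Zp
    using p1 by unfold_locales (simp_all add: Zp_def)
  have A: "A \<subseteq> {1..int p - 1}"
    using assms(3) by (auto simp: res_carrier_eq res_zero_eq)
  have finA: "finite A"
    using A finite_subset by blast
  have "card ({1..int p - 1} - A) = 2"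
    using A finA assms(4,5) by (subst card_Diff_subset) auto
  then obtain x y where xy: "{1..int p - 1} - A = {x, y}" "x \<noteq> y"
    by (auto simp: card_2_iff)
  have xyr: "x \<in> {1..int p - 1}" "y \<in> {1..int p - 1}"
    using xy by blast+
  \<comment> \<open>All nonzero residues add up to \<open>p * h\<close>, so \<open>x + y\<close> is
    congruent to minus the sum of \<open>A\<close>.\<close>
  have nd: "\<not> int p dvd x + y"
  proof
    assume d: "int p dvd x + y"
    have "(\<Sum>a\<in>{1..int p - 1}. a) = \<Sum> A + (x + y)"
      using sum.subset_diff[OF A, of "\<lambda>a. a"] xy by simp
    moreover have "(\<Sum>a\<in>{1..int p - 1}. a) = int p * int h"
    proof -
      have "(\<Sum>a\<in>{1..int n}. a) * 2 = int n * (int n + 1)" for n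
      proof (induction n)
        case (Suc n)
        have "{1..int (Suc n)} = insert (int (Suc n)) {1..int n}"
          by auto
        with Suc show ?case
          by (simp add: algebra_simps)
      qed simp
      from this[of "2 * h"] show ?thesis
        by (simp add: ip algebra_simps)
    qed
    ultimately have "int p dvd \<Sum> A"
      using d by (metis dvd_add_left_iff dvd_triv_left)
    moreover have "(\<Oplus>\<^bsub>Zp\<^esub>a\<in>A. a) = (\<Oplus>\<^bsub>Zp\<^esub>a\<in>A. a mod int p)"
      using A by (intro finsum_cong') (auto simp: mod_in_carrier)
    ultimately show False
      using assms(6) finA by (simp add: sum_cong res_zero_eq)
  qed
  have ndv: "\<not> int p dvd a" if "0 < \<bar>a\<bar>" "\<bar>a\<bar> < int p" for a
    using that dvd_imp_le_int[of a "int p"] by auto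
  have "\<not> int p dvd x" "\<not> int p dvd y" "\<not> int p dvd x - y"
    using xyr xy(2) by (intro ndv; auto)+
  moreover have "prime (int p)"
    using \<open>prime p\<close> by simp
  ultimately obtain x' y' c j where xy': "{x', y'} = {x, y}" and j: "Suc j < h"
      and c: "coprime c (int p)" and x': "[x' = c * zz_diff h j] (mod int p)"
      and y': "[y' = c * zz_diff h (Suc j)] (mod int p)"
    using adjacent_zz_diffs[of h x y, folded ip] nd by blast

  \<comment> \<open>The path left after deleting a vertex\<close>
  have xyd: "{1..int p - 1} - A = {x', y'}"
    using xy xy' by simp
  \<comment> \<open>Differences \<open>j\<close> and \<open>j + 1\<close> meet at vertex
    \<open>j + 1\<close>, the one to delete. The path therefore starts at \<open>j + 2\<close> and
    runs cyclically to \<open>j\<close>.\<close>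
  define s where "s t = (j + 2 + t) mod (2 * h)" for t
  define w where "w t = c * zz_vertex h (s t)" for t
  define as where "as = map (\<lambda>t. (w (Suc t) - w t) mod int p) [0..<k]"
  have k: "k = 2 * h - 2" "1 < h"
    using assms(5) p j by auto
  have s_less: "s t < 2 * h" for t
    using k by (simp add: s_def)
  have s_inj: "t = t'" if "s t = s t'" "t < 2 * h" "t' < 2 * h" for t t'
  proof -
    have "[j + 2 + t = j + 2 + t'] (mod 2 * h)"
      using that(1) by (simp add: s_def cong_def)
    then have "[t = t'] (mod 2 * h)"
      by (simp only: cong_add_lcancel_nat)
    then show ?thesis
      using that(2,3) cong_less_modulus_unique_nat by blast
  qed
  \<comment> \<open>The two steps after the path are those with differences \<open>x'\<close> and
    \<open>y'\<close>.\<close>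
  have s_last: "s k = j" "s (Suc k) = Suc j"
  proof -
    have "j + 2 + k = j + 2 * h" "j + 2 + Suc k = Suc j + 2 * h"
      using k by auto
    then show "s k = j" "s (Suc k) = Suc j"
      using j unfolding s_def by (simp_all only: mod_add_self2 mod_less)
  qed
  have step: "[w (Suc t) - w t = c * zz_diff h (s t)] (mod int p)" for t
  proof -
    have "s (Suc t) = Suc (s t) mod (2 * h)"
      by (simp add: s_def mod_Suc_eq)
    with zz_vertex_step[OF s_less, of t]
    have "[c * (zz_vertex h (s (Suc t)) - zz_vertex h (s t)) = c * zz_diff h (s t)] (mod int p)"
      by (simp add: ip cong_scalar_left)
    then show ?thesis
      by (simp add: w_def right_diff_distrib)
  qed
  \<comment> \<open>Injectivity covers the full cycle of \<open>2 * h\<close> steps, so that path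
    differences can be separated from those of the omitted steps \<open>k\<close> and
    \<open>Suc k\<close>.\<close>
  have d_inj: "t = t'"
    if "[c * zz_diff h (s t) = c * zz_diff h (s t')] (mod int p)" "t < 2 * h" "t' < 2 * h" for t t'
    using that c s_inj zz_diff_cong_imp_eq[OF s_less s_less] by (simp add: cong_mult_lcancel ip)
  have nth: "[as ! t = c * zz_diff h (s t)] (mod int p)" if "t < k" for t
    using that step[of t] by (simp add: as_def)
  have lt: "t < 2 * h" "t \<noteq> Suc k" if "t < k" for t
    using that k by linarith+

  \<comment> \<open>The differences of the path as an ordering of \<open>A\<close>\<close>
  have len: "length as = k"
    by (simp add: as_def)
  have dist: "distinct as"
    unfolding distinct_conv_nth len
  proof (intro allI impI)
    fix t t' assume t: "t < k" "t' < k" "t \<noteq> t'"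
    show "as ! t \<noteq> as ! t'"
    proof
      assume "as ! t = as ! t'"
      then have "[c * zz_diff h (s t) = c * zz_diff h (s t')] (mod int p)"
        using nth[OF t(1)] nth[OF t(2)] by (metis cong_sym cong_trans)
      then show False
        using d_inj lt t by blast
    qed
  qed
  have "set as \<subseteq> A"
  proof
    fix a assume "a \<in> set as"
    then obtain t where t: "t < k" "a = as ! t"
      by (auto simp: in_set_conv_nth len)
    have "\<not> [c * zz_diff h (s t) = c * 0] (mod int p)"
      using zz_diff_not_cong_0[OF s_less, of t] c by (simp add: cong_mult_lcancel ip del: mult_zero_right)
    then have "a \<noteq> 0"
      using nth[OF t(1)] t(2) by (auto simp: cong_sym_eq)
    moreover have "0 \<le> a" "a < int p"
      using t p1 by (auto simp: as_def)
    moreover have "a \<noteq> x'"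
    proof
      assume "a = x'"
      then have "[c * zz_diff h (s t) = c * zz_diff h (s k)] (mod int p)"
        using nth[OF t(1)] x' unfolding t(2) s_last by (metis cong_sym cong_trans)
      then have "t = k"
        using d_inj lt(1)[OF t(1)] k by simp
      with t(1) show False
        by simp
    qed
    moreover have "a \<noteq> y'"
    proof
      assume "a = y'"
      then have "[c * zz_diff h (s t) = c * zz_diff h (s (Suc k))] (mod int p)"
        using nth[OF t(1)] y' unfolding t(2) s_last by (metis cong_sym cong_trans)
      then have "t = Suc k"
        using d_inj lt(1)[OF t(1)] k by simp
      with lt(2)[OF t(1)] show False
        by simp
    qed
    ultimately have "a \<in> {1..int p - 1} - {x', y'}"
      by simp
    then show "a \<in> A"
      using xyd by blast
  qed
  then have "set as = A"
    using finA assms(4) len distinct_card[OF dist] by (simp add: card_subset_eq)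
  moreover have "partial_sum Zp as n \<noteq> partial_sum Zp as m" if "n < m" "m \<le> k" for n m
  proof
    assume "partial_sum Zp as n = partial_sum Zp as m"
    then have "[w n - w 0 = w m - w 0] (mod int p)"
      using that p1 by (simp add: as_def Zp_def partial_sum_differences cong_def)
    from cong_add[OF this cong_refl[of "w 0"]] have "[w n = w m] (mod int p)"
      by simp
    \<comment> \<open>\<open>c\<close> is invertible modulo \<open>p\<close>, so scaling keeps the
      zigzag vertices distinct.\<close>
    then have "s n = s m"
      using c zz_vertex_cong_imp_eq[OF s_less s_less] by (simp add: w_def cong_mult_lcancel ip)
    then show False
      using s_inj[of n m] that k by linarith
  qed
  ultimately show ?thesis
    using len dist by blast
qed

end
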